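(* Given bounds $\overline{|S|}\ge|S|$, $0<\underline{p}_{\min}\le p_{\min}$ and $\overline{r}_{\max}\ge r_{\max}$, one can give PAC guarantees on the reachability reward $E_{\diamond G}$ (assumed finite). That is, there is a statistical procedure which, given $\overline{|S|}\in\mathbb{N}$, $\underline{p}_{\min}>0$, $\overline{r}_{\max}\ge 0$, a confidence level $\gamma\in(0,1)$ and a precision $\varepsilon>0$, draws a finite number $k$ (chosen by the procedure) of independent random runs and returns an interval $I$ with $|I|\le2\varepsilon$, such that for every DTMC $\langle S,R,T,s_I\rangle$ and goal set $G\subseteq S$ with $E_{\diamond G}<\infty$, $|S|\le\overline{|S|}$, $p_{\min}\ge\underline{p}_{\min}$ and $r_{\max}\le\overline{r}_{\max}$, when the runs are drawn from this DTMC, the probability that $E_{\diamond G}\in I$ is at least $\gamma$.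
   Context: **Discrete-time Markov chain (DTMC).** A tuple $\langle S,R,T,s_I\rangle$ with a finite set of states $S$, a reward function $R:S\to\mathbb{R}_{\ge0}$, an initial state $s_I\in S$, and a transition function $T$ mapping each state to a probability distribution over $S$. A path is an infinite sequence $\pi=s_0s_1\ldots\in S^\omega$ with $s_0=s_I$ and $T(s_i)(s_{i+1})>0$ for all $i$; write $\pi[i]=s_i$. The DTMC induces the usual probability measure $\mathbb{P}$ on sets of paths; $\mathbb{E}$ is expectation with respect to $\mathbb{P}$. **Notation.** $r_{\max}=\max\{R(s)\mid s\in S\}$; $p_{\min}=\min(\{T(s)(s')\mid s,s'\in S\}\setminus\{0\})$; $\mathit{idx}(\pi,G)=\min\{i\in\mathbb{N}\mid s_i\in G\}$, with $\mathit{idx}(\pi,G)=\infty$ if $\pi$ never visits $G$. **Reachability reward.** $\mathit{PR}(\pi)=\sum_{i=0}^{\mathit{idx}(\pi,G)}R(\pi[i])$ and $E_{\diamond G}=\mathbb{E}(\mathit{PR})$, where by convention $E_{\diamond G}=\infty$ if $\mathbb{P}(\{\pi\mid\mathit{idx}(\pi,G)=\infty\})>0$. **Access model.** The procedure does not know the DTMC; it only observes independent runs sampled according to $\mathbb{P}$, each run being generated until its first visit to $G$, so that for each run $\pi$ the visited prefix, and in particular the values $\mathit{PR}(\pi)$ and $\mathit{idx}(\pi,G)$, are observed. **PAC guarantee.** A procedure is probably approximately correct (PAC) for a quantity $x$ if it returns an interval $I$ of width $|I|\le2\varepsilon$ such that the probability (over the sampled runs) that $x\in I$ is at least the confidence level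 $\gamma$. *)

theory Defs
  imports "HOL-Probability.Probability"
begin

text \<open>
  Markov chains over a state set \<open>S\<close> of an arbitrary type. Only the values of \<open>R\<close> and \<open>T\<close> on \<open>S\<close>
  matter: since \<open>S\<close> is closed under \<open>T\<close> and contains \<open>sI\<close>, runs almost surely stay in \<open>S\<close>.
\<close>

locale dtmc =
  fixes S :: "'a set" and R :: "'a \<Rightarrow> real" and T :: "'a \<Rightarrow> 'a pmf" and sI :: 'a
  assumes finite_S: "finite S"
    and R_nonneg: "\<And>s. s \<in> S \<Longrightarrow> 0 \<le> R s"
    and T_closed: "\<And>s. s \<in> S \<Longrightarrow> set_pmf (T s) \<subseteq> S"
    and sI_in_S: "sI \<in> S"

definition r_max :: "'a set \<Rightarrow> ('a \<Rightarrow> real) \<Rightarrow> real" where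
  "r_max S R = Max (R ` S)"

definition p_min :: "'a set \<Rightarrow> ('a \<Rightarrow> 'a pmf) \<Rightarrow> real" where
  "p_min S T = Min ({pmf (T s) s' | s s'. s \<in> S \<and> s' \<in> S} - {0})"

text \<open>
  The law of the state sequence, obtained from the Ionescu-Tulcea construction: state \<open>0\<close> is \<open>sI\<close>,
  and state \<open>Suc i\<close> is drawn from \<open>T\<close> at state \<open>i\<close>. The underlying space consists of all sequences
  of states; those with a transition of probability \<open>0\<close> form a null set. The values on cylinder
  sets are computed in \<open>path_measure_cylinder\<close> below.
\<close>

definition step_kernel :: "('a \<Rightarrow> 'a pmf) \<Rightarrow> 'a \<Rightarrow> nat \<Rightarrow> (nat \<Rightarrow> 'a) \<Rightarrow> 'a measure" where
  "step_kernel T sI i \<pi> = measure_pmf (if i = 0 then return_pmf sI else T (\<pi> (i - 1)))"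

definition path_measure :: "('a \<Rightarrow> 'a pmf) \<Rightarrow> 'a \<Rightarrow> (nat \<Rightarrow> 'a) measure" where
  "path_measure T sI =
     projective_family.lim UNIV
       (Ionescu_Tulcea.CI (step_kernel T sI) (\<lambda>_. count_space UNIV)) (\<lambda>_. count_space UNIV)"

lemma step_kernel_measurable:
  "step_kernel T sI i \<in> measurable (PiM {0..<i} (\<lambda>_. count_space UNIV)) (subprob_algebra (count_space UNIV))"
proof (cases i)
  case 0
  then show ?thesis
    by (auto simp: step_kernel_def[abs_def] space_subprob_algebra intro!: measurable_const
        prob_space_imp_subprob_space measure_pmf.prob_space_axioms)
next
  case (Suc n)
  have "(\<lambda>\<pi>. \<pi> n) \<in> measurable (PiM {0..<i} (\<lambda>_. count_space UNIV)) (count_space UNIV)"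
    using Suc by (intro measurable_component_singleton) auto
  moreover have "(\<lambda>s. measure_pmf (T s)) \<in> measurable (count_space UNIV) (subprob_algebra (count_space UNIV))"
    by (auto simp: space_subprob_algebra
        intro!: prob_space_imp_subprob_space measure_pmf.prob_space_axioms)
  ultimately have "(\<lambda>\<pi>. measure_pmf (T (\<pi> n))) \<in>
      measurable (PiM {0..<i} (\<lambda>_. count_space UNIV)) (subprob_algebra (count_space UNIV))"
    by (rule measurable_compose)
  with Suc show ?thesis
    by (simp add: step_kernel_def[abs_def])
qed

lemma Ionescu_Tulcea_step_kernel: "Ionescu_Tulcea (step_kernel T sI) (\<lambda>_. count_space UNIV)"
proof (rule Ionescu_Tulcea.intro)
  show "prob_space (step_kernel T sI i x)" for i x
    by (simp add: step_kernel_def measure_pmf.prob_space_axioms)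
qed (rule step_kernel_measurable)

lemma sets_path_measure: "sets (path_measure T sI) = sets (PiM UNIV (\<lambda>_. count_space UNIV))"
proof -
  interpret Ionescu_Tulcea "step_kernel T sI" "\<lambda>_. count_space UNIV"
    by (rule Ionescu_Tulcea_step_kernel)
  show ?thesis unfolding path_measure_def by (rule PF.sets_lim)
qed

lemma space_path_measure: "space (path_measure T sI) = UNIV"
  using sets_eq_imp_space_eq[OF sets_path_measure, of T sI] by (simp add: space_PiM)

lemma path_measure_cylinder:
  "emeasure (path_measure T sI) {\<pi>. \<forall>i\<le>n. \<pi> i = x i} =
     (if x 0 = sI then ennreal (\<Prod>i<n. pmf (T (x i)) (x (Suc i))) else 0)"
proof -
  interpret Ionescu_Tulcea "step_kernel T sI" "\<lambda>_. count_space UNIV"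
    by (rule Ionescu_Tulcea_step_kernel)
  let ?M = "\<lambda>_::nat. count_space (UNIV::'a set)"
  define X where "X n = {restrict x {0..<n}}" for n
  have X_PiE: "X n = (\<Pi>\<^sub>E i\<in>{0..<n}. {x i})" for n
    unfolding X_def by (auto simp: PiE_iff extensional_def fun_eq_iff)
  have X_sets: "X n \<in> sets (PiM {0..<n} ?M)" for n
    unfolding X_PiE by (intro sets_PiM_I_finite) auto
  have C_step: "emeasure (C 0 (Suc m) (\<lambda>_. undefined)) (X (Suc m)) =
      emeasure (C 0 m (\<lambda>_. undefined)) (X m) * ennreal (pmf (if m = 0 then return_pmf sI else T (x (m - 1))) (x m))"
    (is "_ = _ * ?p") for m
  proof -
    have emeasure_eP': "emeasure (eP m \<omega>) (X (Suc m)) = indicator (X m) \<omega> * ?p"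
      if \<omega>: "\<omega> \<in> space (PiM {0..<m} ?M)" for \<omega>
    proof -
      from \<omega> have ext_\<omega>: "\<omega> \<in> extensional {0..<m}" by (simp add: space_PiM PiE_def)
      have eq: "(fun_upd \<omega> m y = restrict x {0..<Suc m}) \<longleftrightarrow> \<omega> = restrict x {0..<m} \<and> y = x m" for y
      proof
        assume upd: "fun_upd \<omega> m y = restrict x {0..<Suc m}"
        have "\<omega> i = restrict x {0..<m} i" for i
          using fun_cong[OF upd, of i] extensional_arb[OF ext_\<omega>, of i] by (cases "i < m") auto
        moreover have "y = x m"
          using fun_cong[OF upd, of m] by simp
        ultimately show "\<omega> = restrict x {0..<m} \<and> y = x m"
          by blast
      next
        assume "\<omega> = restrict x {0..<m} \<and> y = x m"
        then have "fun_upd \<omega> m y i = restrict x {0..<Suc m} i" for i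
          by (cases "i = m"; cases "i < m") simp_all
        then show "fun_upd \<omega> m y = restrict x {0..<Suc m}"
          by (rule ext)
      qed
      show ?thesis
      proof (cases "\<omega> = restrict x {0..<m}")
        case True
        have "fun_upd \<omega> m -` X (Suc m) \<inter> space (?M m) = {y. fun_upd \<omega> m y = restrict x {0..<Suc m}}"
          unfolding X_def space_count_space by blast
        also have "\<dots> = {x m}"
          unfolding eq using True by blast
        finally have "fun_upd \<omega> m -` X (Suc m) \<inter> space (?M m) = {x m}" .
        moreover have "step_kernel T sI m \<omega> = measure_pmf (if m = 0 then return_pmf sI else T (x (m - 1)))"
          using True by (auto simp: step_kernel_def)
        ultimately show ?thesis
          using True by (subst emeasure_eP[OF \<omega> X_sets]) (simp add: emeasure_pmf_single X_def)
      next
        case False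
        have "fun_upd \<omega> m -` X (Suc m) \<inter> space (?M m) = {y. fun_upd \<omega> m y = restrict x {0..<Suc m}}"
          unfolding X_def space_count_space by blast
        also have "\<dots> = {}"
          unfolding eq using False by blast
        finally have "fun_upd \<omega> m -` X (Suc m) \<inter> space (?M m) = {}" .
        with False show ?thesis
          by (subst emeasure_eP[OF \<omega> X_sets]) (simp add: X_def)
      qed
    qed
    have u: "(\<lambda>_. undefined) \<in> space (PiM {0..<0} ?M)" by (simp add: space_PiM)
    have "emeasure (C 0 (Suc m) (\<lambda>_. undefined)) (X (Suc m)) =
        (\<integral>\<^sup>+\<omega>. emeasure (eP m \<omega>) (X (Suc m)) \<partial>C 0 m (\<lambda>_. undefined))"
      unfolding C.simps add_0
    proof (rule emeasure_bind)
      show "space (C 0 m (\<lambda>_. undefined)) \<noteq> {}"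
        by (rule prob_space.not_empty[OF prob_space_C[OF u]])
      show "eP m \<in> measurable (C 0 m (\<lambda>_. undefined)) (subprob_algebra (PiM {0..<Suc m} ?M))"
        using measurable_eP[of m] unfolding measurable_cong_sets[OF sets_C[OF u, of m] refl] by simp
      show "X (Suc m) \<in> sets (PiM {0..<Suc m} ?M)"
        by (rule X_sets)
    qed
    also have "\<dots> = (\<integral>\<^sup>+\<omega>. indicator (X m) \<omega> * ?p \<partial>C 0 m (\<lambda>_. undefined))"
      by (intro nn_integral_cong emeasure_eP') (simp add: space_C[OF u])
    also have "\<dots> = emeasure (C 0 m (\<lambda>_. undefined)) (X m) * ?p"
      using X_sets[of m] sets_C[OF u, of m]
      by (subst nn_integral_multc) (auto intro!: borel_measurable_indicator)
    finally show ?thesis .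
  qed
  have C_X: "emeasure (C 0 (Suc m) (\<lambda>_. undefined)) (X (Suc m)) =
      (if x 0 = sI then ennreal (\<Prod>i<m. pmf (T (x i)) (x (Suc i))) else 0)" for m
  proof (induction m)
    case 0
    have "emeasure (C 0 0 (\<lambda>_. undefined)) (X 0) = 1"
      using X_sets[of 0] by (auto simp: X_def restrict_def)
    then show ?case by (subst C_step) (simp add: pmf_return indicator_def)
  next
    case (Suc m)
    show ?case by (subst C_step) (simp add: Suc ennreal_mult prod_nonneg del: C.simps)
  qed
  have "{\<pi>. \<forall>i\<le>n. \<pi> i = x i} = PF.emb UNIV {0..<Suc n} (X (Suc n))"
    unfolding X_PiE by (subst prod_emb_PiE) (auto simp: PiE_iff less_Suc_eq_le split: if_splits)
  then show ?thesis
    unfolding path_measure_def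
    using lim[of "{0..<Suc n}" "X (Suc n)"] emeasure_CI[of "{0..<Suc n}" "Suc n" "X (Suc n)"]
      X_sets[of "Suc n"] prod_emb_id[of "X (Suc n)" "{0..<Suc n}" ?M]
      sets.sets_into_space[OF X_sets[of "Suc n"]] C_X[of n]
    unfolding space_PiM by (simp del: C.simps)
qed

lemma prob_space_path_measure: "prob_space (path_measure T sI)"
proof -
  interpret Ionescu_Tulcea "step_kernel T sI" "\<lambda>_. count_space UNIV"
    by (rule Ionescu_Tulcea_step_kernel)
  let ?M = "\<lambda>_::nat. count_space (UNIV::'a set)"
  interpret CI: prob_space "CI {}"
    by (rule PF.prob_space_P) auto
  have "emeasure (path_measure T sI) (PF.emb UNIV {} (space (PiM {} ?M))) = 1"
    using lim[of "{}" "space (PiM {} ?M)"] CI.emeasure_space_1 PF.space_P[of "{}"]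
    unfolding path_measure_def by simp
  moreover have "PF.emb UNIV {} (space (PiM {} ?M)) = space (path_measure T sI)"
    unfolding space_path_measure by (auto simp: prod_emb_def space_PiM)
  ultimately show ?thesis
    by (intro prob_spaceI) simp
qed

definition idx :: "(nat \<Rightarrow> 'a) \<Rightarrow> 'a set \<Rightarrow> enat" where
  "idx \<pi> G = Inf {enat i | i. \<pi> i \<in> G}"

definition path_reward :: "('a \<Rightarrow> real) \<Rightarrow> 'a set \<Rightarrow> (nat \<Rightarrow> 'a) \<Rightarrow> ennreal" where
  "path_reward R G \<pi> = (\<Sum>i. if enat i \<le> idx \<pi> G then ennreal (R (\<pi> i)) else 0)"

definition reach_reward :: "('a \<Rightarrow> real) \<Rightarrow> ('a \<Rightarrow> 'a pmf) \<Rightarrow> 'a \<Rightarrow> 'a set \<Rightarrow> ennreal" where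
  "reach_reward R T sI G =
     (if emeasure (path_measure T sI) {\<pi>. idx \<pi> G = \<infinity>} > 0 then \<infinity>
      else \<integral>\<^sup>+\<pi>. path_reward R G \<pi> \<partial>path_measure T sI)"

text \<open>
  What is seen of one run: the states visited up to the first visit to \<open>G\<close> (a partial sequence with
  domain \<open>{i. enat i \<le> idx \<pi> G}\<close>), the accumulated reward, and the index of the first visit.
\<close>

type_synonym 'a observation = "(nat \<rightharpoonup> 'a) \<times> ennreal \<times> enat"

definition observe :: "('a \<Rightarrow> real) \<Rightarrow> 'a set \<Rightarrow> (nat \<Rightarrow> 'a) \<Rightarrow> 'a observation" where
  "observe R G \<pi> =
     ((\<lambda>i. if enat i \<le> idx \<pi> G then Some (\<pi> i) else None), path_reward R G \<pi>, idx \<pi> G)"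

definition interval_of_width :: "real \<Rightarrow> real set \<Rightarrow> bool" where
  "interval_of_width w I \<longleftrightarrow> (\<exists>a b. a \<le> b \<and> b - a \<le> w \<and> I = {a..b})"

text \<open>
  The probability that the interval computed by \<open>A\<close> from the observations of \<open>k\<close> independent runs
  contains \<open>x\<close>. As \<open>measure\<close> is \<open>0\<close> on non-measurable sets, a positive lower bound on \<open>coverage\<close>
  includes measurability of the event.
\<close>

definition coverage ::
    "('a \<Rightarrow> real) \<Rightarrow> ('a \<Rightarrow> 'a pmf) \<Rightarrow> 'a \<Rightarrow> 'a set \<Rightarrow> nat \<Rightarrow> ('a observation list \<Rightarrow> real set) \<Rightarrow> real \<Rightarrow> real"
  where
  "coverage R T sI G k A x =
     (let M = PiM {..<k} (\<lambda>_. path_measure T sI) in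
      measure M {\<omega> \<in> space M. x \<in> A (map (\<lambda>j. observe R G (\<omega> j)) [0..<k])})"

end

(* If the expected reward is finite, G is hit almost surely, so from every state occupied with positive
   probability before hitting G there is a path to G, of length at most |S|^2 (the number of edges).
   Following it has probability at least p^(|S|^2), uniformly in the state; hence the hitting time has
   geometric tails with constants depending only on the bounds for |S| and p_min. With the bound for
   r_max this bounds the second moment of the path reward, and Chebyshev's inequality applied to the
   sample mean gives the number of runs. *)

theory Submission
  imports Defs
begin

text \<open>No uniform chance of reaching \<open>G\<close> can be claimed for every state: one that
  is entered only after the first visit to \<open>G\<close>, or never, may have no path to
  \<open>G\<close>. Probabilities on the path space come from the cylinder formula, so a history to
  which the Markov property is applied allows only finitely many states at each time; this is why
  \<open>S - G\<close> occurs instead of the complement of \<open>G\<close>. Chebyshev's inequality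
  fits because path rewards are in general unbounded, even with all parameters fixed. The parameter
  bounds influence only the number of runs: the interval is always the sample mean plus or minus
  \<open>\<epsilon>\<close>.\<close>

section \<open>Measurability and the Markov property of the path measure\<close>

lemma measurable_path_component [measurable]:
  "(\<lambda>\<pi>. \<pi> i) \<in> path_measure T sI \<rightarrow>\<^sub>M count_space UNIV"
  unfolding measurable_cong_sets[OF sets_path_measure refl]
  by (rule measurable_component_singleton) simp

lemma pred_path_component [measurable]: "Measurable.pred (path_measure T sI) (\<lambda>\<pi>. \<pi> i \<in> B)"
  by (rule measurable_compose[OF measurable_path_component]) simp

lemma pred_path_component_eq [measurable]: "Measurable.pred (path_measure T sI) (\<lambda>\<pi>. \<pi> i = s)"
  by (rule measurable_compose[OF measurable_path_component]) simp

lemma measure_path_measure_cylinder: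
  "measure (path_measure T sI) {\<pi>. \<forall>i\<le>n. \<pi> i = x i} =
     (if x 0 = sI then \<Prod>i<n. pmf (T (x i)) (x (Suc i)) else 0)"
  by (simp add: measure_def path_measure_cylinder prod_nonneg)

lemma path_sets_Collect:
  assumes "Measurable.pred (path_measure T sI) Q"
  shows "{\<pi>. Q \<pi>} \<in> sets (path_measure T sI)"
  using predE[OF assms] by (simp add: space_path_measure)

text \<open>Finiteness of the sets \<open>B j\<close> makes the history a finite disjoint union of
  cylinders, to each of which the product formula applies. Letting \<open>B\<close> vary with time
  allows a later proof to encode an already followed path as part of the history.\<close>

lemma path_measure_Markov:
  assumes B: "\<And>j. j \<le> i \<Longrightarrow> finite (B j)"
  shows "measure (path_measure T sI) {\<pi>. (\<forall>j\<le>i. \<pi> j \<in> B j) \<and> \<pi> i = s \<and> \<pi> (Suc i) = t} =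
    pmf (T s) t * measure (path_measure T sI) {\<pi>. (\<forall>j\<le>i. \<pi> j \<in> B j) \<and> \<pi> i = s}"
proof -
  interpret prob_space "path_measure T sI" by (rule prob_space_path_measure)
  define X where "X = {x \<in> PiE {..i} B. x i = s}"
  have X_sub: "X \<subseteq> PiE {..i} B" by (auto simp: X_def)
  have fin_X: "finite X"
    by (rule finite_subset[OF X_sub]) (auto intro!: finite_PiE B)
  have in_X: "restrict \<pi> {..i} \<in> X" if "\<forall>j\<le>i. \<pi> j \<in> B j" "\<pi> i = s" for \<pi>
    using that by (auto simp: X_def)
  have inj: "x = y" if "x \<in> X" "y \<in> X" "\<forall>j\<le>i. x j = y j" for x y
    using that X_sub by (intro PiE_ext[of x "{..i}" B y]) auto
  let ?C = "\<lambda>x. {\<pi>. \<forall>j\<le>i. \<pi> j = x j}"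
  let ?C' = "\<lambda>x. {\<pi>. \<forall>j\<le>Suc i. \<pi> j = (x(Suc i := t)) j}"
  have C'_eq: "?C' x = {\<pi>. (\<forall>j\<le>i. \<pi> j = x j) \<and> \<pi> (Suc i) = t}" for x
    by (auto simp: le_Suc_eq)
  have sets_C: "?C x \<in> events" for x
    by (intro path_sets_Collect) measurable
  have sets_C': "?C' x \<in> events" for x
    by (intro path_sets_Collect) measurable
  have un: "{\<pi>. (\<forall>j\<le>i. \<pi> j \<in> B j) \<and> \<pi> i = s} = (\<Union>x\<in>X. ?C x)"
  proof (intro set_eqI iffI)
    fix \<pi> assume "\<pi> \<in> {\<pi>. (\<forall>j\<le>i. \<pi> j \<in> B j) \<and> \<pi> i = s}"
    then show "\<pi> \<in> (\<Union>x\<in>X. ?C x)"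
      using in_X[of \<pi>] by (intro UN_I[of "restrict \<pi> {..i}"]) auto
  qed (auto simp: X_def PiE_iff)
  have un': "{\<pi>. (\<forall>j\<le>i. \<pi> j \<in> B j) \<and> \<pi> i = s \<and> \<pi> (Suc i) = t} = (\<Union>x\<in>X. ?C' x)"
  proof (intro set_eqI iffI)
    fix \<pi> assume "\<pi> \<in> {\<pi>. (\<forall>j\<le>i. \<pi> j \<in> B j) \<and> \<pi> i = s \<and> \<pi> (Suc i) = t}"
    then show "\<pi> \<in> (\<Union>x\<in>X. ?C' x)"
      unfolding C'_eq using in_X[of \<pi>] by (intro UN_I[of "restrict \<pi> {..i}"]) auto
  qed (unfold C'_eq, auto simp: X_def PiE_iff)
  have disj: "disjoint_family_on ?C X"
    unfolding disjoint_family_on_def by (auto 0 3 dest: inj)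
  then have disj': "disjoint_family_on ?C' X"
    unfolding disjoint_family_on_def C'_eq by blast
  \<comment> \<open>The longer cylinder has exactly one more factor, \<open>pmf (T (x i)) t\<close>,
    and \<open>x i = s\<close> on \<open>X\<close>.\<close>
  have "prob (?C' x) = pmf (T s) t * prob (?C x)" if "x \<in> X" for x
    using that unfolding measure_path_measure_cylinder by (simp add: X_def)
  then have "(\<Sum>x\<in>X. prob (?C' x)) = pmf (T s) t * (\<Sum>x\<in>X. prob (?C x))"
    unfolding sum_distrib_left by (intro sum.cong refl)
  moreover have "prob (\<Union>x\<in>X. ?C x) = (\<Sum>x\<in>X. prob (?C x))"
    using sets_C disj fin_X by (intro finite_measure_finite_Union) auto
  moreover have "prob (\<Union>x\<in>X. ?C' x) = (\<Sum>x\<in>X. prob (?C' x))"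
    using sets_C' disj' fin_X by (intro finite_measure_finite_Union) blast+
  ultimately show ?thesis
    unfolding un un' by simp
qed

text \<open>Induction on the length of the continuation: the part of \<open>y\<close> followed so
  far is absorbed into the history, where it becomes the singletons of \<open>B'\<close>, and one
  more application of the Markov property yields the next factor.\<close>

lemma path_measure_extend:
  assumes B: "\<And>j. j \<le> i \<Longrightarrow> finite (B j)"
  shows "measure (path_measure T sI) {\<pi>. (\<forall>j\<le>i. \<pi> j \<in> B j) \<and> (\<forall>j\<le>l. \<pi> (i + j) = y j)} =
    (\<Prod>j<l. pmf (T (y j)) (y (Suc j))) *
      measure (path_measure T sI) {\<pi>. (\<forall>j\<le>i. \<pi> j \<in> B j) \<and> \<pi> i = y 0}"
proof (induction l)
  case (Suc l)
  define B' where "B' j = (if j < i then B j else if j = i then B i \<inter> {y 0} else {y (j - i)})" for j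
  have B'_iff: "(\<forall>j\<le>i + l. \<pi> j \<in> B' j) \<longleftrightarrow> (\<forall>j\<le>i. \<pi> j \<in> B j) \<and> (\<forall>j\<le>l. \<pi> (i + j) = y j)" for \<pi>
  proof
    assume *: "\<forall>j\<le>i + l. \<pi> j \<in> B' j"
    have "\<pi> j \<in> B j" if "j \<le> i" for j
      using *[rule_format, of j] that by (auto simp: B'_def split: if_splits)
    moreover have "\<pi> (i + j) = y j" if "j \<le> l" for j
      using *[rule_format, of "i + j"] that by (auto simp: B'_def split: if_splits)
    ultimately show "(\<forall>j\<le>i. \<pi> j \<in> B j) \<and> (\<forall>j\<le>l. \<pi> (i + j) = y j)" by blast
  next
    assume *: "(\<forall>j\<le>i. \<pi> j \<in> B j) \<and> (\<forall>j\<le>l. \<pi> (i + j) = y j)"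
    show "\<forall>j\<le>i + l. \<pi> j \<in> B' j"
    proof (intro allI impI)
      fix j assume "j \<le> i + l"
      then show "\<pi> j \<in> B' j"
        using *[THEN conjunct1, rule_format, of j] *[THEN conjunct2, rule_format, of "j - i"]
        by (auto simp: B'_def)
    qed
  qed
  have split: "(\<forall>j\<le>Suc l. \<pi> (i + j) = y j) \<longleftrightarrow>
      (\<forall>j\<le>l. \<pi> (i + j) = y j) \<and> \<pi> (i + l) = y l \<and> \<pi> (Suc (i + l)) = y (Suc l)" for \<pi>
    by (auto simp: le_Suc_eq)
  have fin: "finite (B' j)" if "j \<le> i + l" for j
    using B[of j] by (auto simp: B'_def)
  have drop: "(\<forall>j\<le>l. \<pi> (i + j) = y j) \<and> \<pi> (i + l) = y l \<longleftrightarrow> (\<forall>j\<le>l. \<pi> (i + j) = y j)" for \<pi>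
    by blast
  have "measure (path_measure T sI) {\<pi>. (\<forall>j\<le>i + l. \<pi> j \<in> B' j) \<and> \<pi> (i + l) = y l \<and> \<pi> (Suc (i + l)) = y (Suc l)} =
      pmf (T (y l)) (y (Suc l)) *
        measure (path_measure T sI) {\<pi>. (\<forall>j\<le>i + l. \<pi> j \<in> B' j) \<and> \<pi> (i + l) = y l}"
    by (rule path_measure_Markov) (rule fin)
  with Suc show ?case
    unfolding B'_iff split by (simp add: conj_assoc drop)
qed simp

section \<open>Runs stay in \<open>S\<close> and follow transitions of positive probability\<close>

context dtmc
begin

interpretation path: prob_space "path_measure T sI"
  by (rule prob_space_path_measure)

lemma prob_path_split:
  assumes Q[measurable]: "Measurable.pred (path_measure T sI) Q"
  shows "path.prob {\<pi>. Q \<pi> \<and> \<pi> i \<in> S} = (\<Sum>s\<in>S. path.prob {\<pi>. Q \<pi> \<and> \<pi> i = s})"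
proof -
  have "{\<pi>. Q \<pi> \<and> \<pi> i = s} \<in> path.events" for s
    by (intro path_sets_Collect) measurable
  then have "path.prob (\<Union>s\<in>S. {\<pi>. Q \<pi> \<and> \<pi> i = s}) = (\<Sum>s\<in>S. path.prob {\<pi>. Q \<pi> \<and> \<pi> i = s})"
    using finite_S by (intro path.finite_measure_finite_Union) (auto simp: disjoint_family_on_def)
  moreover have "(\<Union>s\<in>S. {\<pi>. Q \<pi> \<and> \<pi> i = s}) = {\<pi>. Q \<pi> \<and> \<pi> i \<in> S}"
    by blast
  ultimately show ?thesis by simp
qed

lemma prob_path_mono:
  assumes "Measurable.pred (path_measure T sI) Q'" "\<And>\<pi>. Q \<pi> \<Longrightarrow> Q' \<pi>"
  shows "path.prob {\<pi>. Q \<pi>} \<le> path.prob {\<pi>. Q' \<pi>}"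
  using assms by (intro path.finite_measure_mono path_sets_Collect) auto

lemma prob_path_cong_AE:
  assumes "Measurable.pred (path_measure T sI) Q" "Measurable.pred (path_measure T sI) Q'"
    and "AE \<pi> in path_measure T sI. Q \<pi> \<longleftrightarrow> Q' \<pi>"
  shows "path.prob {\<pi>. Q \<pi>} = path.prob {\<pi>. Q' \<pi>}"
  using assms(3) path_sets_Collect[OF assms(1)] path_sets_Collect[OF assms(2)]
  by (intro path.finite_measure_eq_AE) auto

text \<open>The path space contains all sequences over the type, so this is not built in. No mass is
  lost in a step because each \<open>T s\<close> with \<open>s \<in> S\<close> sums to 1 over
  \<open>S\<close>.\<close>

lemma prob_path_in_S: "path.prob {\<pi>. \<forall>j\<le>i. \<pi> j \<in> S} = 1"
proof (induction i)
  case 0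
  have "path.prob {\<pi>. \<pi> 0 = s} = (if s = sI then 1 else 0)" for s
    using measure_path_measure_cylinder[of T sI 0 "\<lambda>_. s"] by simp
  then show ?case
    using prob_path_split[of "\<lambda>_. True" 0] finite_S sI_in_S by simp
next
  case (Suc i)
  let ?Q = "\<lambda>\<pi>. \<forall>j\<le>i. \<pi> j \<in> S"
  have "path.prob {\<pi>. \<forall>j\<le>Suc i. \<pi> j \<in> S} = path.prob {\<pi>. (?Q \<pi> \<and> \<pi> (Suc i) \<in> S) \<and> \<pi> i \<in> S}"
    by (intro arg_cong[where f = path.prob]) (auto simp: le_Suc_eq)
  also have "\<dots> = (\<Sum>s\<in>S. path.prob {\<pi>. (?Q \<pi> \<and> \<pi> (Suc i) \<in> S) \<and> \<pi> i = s})"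
    by (rule prob_path_split) measurable
  also have "\<dots> = (\<Sum>s\<in>S. path.prob {\<pi>. (?Q \<pi> \<and> \<pi> i = s) \<and> \<pi> (Suc i) \<in> S})"
    by (intro sum.cong refl arg_cong[where f = path.prob]) blast
  also have "\<dots> = (\<Sum>s\<in>S. \<Sum>t\<in>S. path.prob {\<pi>. (?Q \<pi> \<and> \<pi> i = s) \<and> \<pi> (Suc i) = t})"
    by (intro sum.cong refl prob_path_split) measurable
  also have "\<dots> = (\<Sum>s\<in>S. \<Sum>t\<in>S. pmf (T s) t * path.prob {\<pi>. ?Q \<pi> \<and> \<pi> i = s})"
    unfolding conj_assoc by (intro sum.cong refl path_measure_Markov finite_S)
  also have "\<dots> = (\<Sum>s\<in>S. path.prob {\<pi>. ?Q \<pi> \<and> \<pi> i = s})"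
    by (intro sum.cong refl) (simp add: sum_distrib_right[symmetric] sum_pmf_eq_1 finite_S T_closed)
  also have "\<dots> = path.prob {\<pi>. ?Q \<pi> \<and> \<pi> i \<in> S}"
    by (rule prob_path_split[symmetric]) measurable
  also have "\<dots> = 1"
    using Suc by (simp cong: conj_cong add: conj_absorb[of "_ \<in> S"])
  finally show ?case .
qed

lemma AE_path_in_S: "AE \<pi> in path_measure T sI. \<forall>i. \<pi> i \<in> S"
  unfolding AE_all_countable
proof
  fix i
  show "AE \<pi> in path_measure T sI. \<pi> i \<in> S"
    using path.AE_prob_1[OF prob_path_in_S[of i]] by eventually_elim auto
qed

lemma AE_path_step: "AE \<pi> in path_measure T sI. \<forall>i. pmf (T (\<pi> i)) (\<pi> (Suc i)) > 0"
  unfolding AE_all_countable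
proof
  fix i
  \<comment> \<open>Only finitely many pairs of states have to be excluded. The conjunct about times
    up to \<open>i\<close> gives the event the shape of \<open>path_measure_Markov\<close> with
    finite sets.\<close>
  have "AE \<pi> in path_measure T sI. \<forall>s\<in>S. \<forall>t\<in>{t\<in>S. pmf (T s) t = 0}.
      \<not> ((\<forall>j\<le>i. \<pi> j \<in> S) \<and> \<pi> i = s \<and> \<pi> (Suc i) = t)"
  proof (intro AE_finite_allI finite_S)
    fix s t assume st: "t \<in> {t\<in>S. pmf (T s) t = 0}"
    let ?E = "{\<pi>. (\<forall>j\<le>i. \<pi> j \<in> S) \<and> \<pi> i = s \<and> \<pi> (Suc i) = t}"
    have "?E \<in> path.events"
      by (intro path_sets_Collect) measurable
    moreover have "path.prob ?E = 0"
      using path_measure_Markov[of i "\<lambda>_. S" T sI s t] st finite_S by simp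
    ultimately have "?E \<in> null_sets (path_measure T sI)"
      by (auto intro!: null_setsI simp: path.emeasure_eq_measure)
    then show "AE \<pi> in path_measure T sI. \<not> ((\<forall>j\<le>i. \<pi> j \<in> S) \<and> \<pi> i = s \<and> \<pi> (Suc i) = t)"
      by (rule AE_I') auto
  qed (use finite_S in auto)
  with AE_path_in_S show "AE \<pi> in path_measure T sI. pmf (T (\<pi> i)) (\<pi> (Suc i)) > 0"
  proof eventually_elim
    case (elim \<pi>)
    then have "pmf (T (\<pi> i)) (\<pi> (Suc i)) \<noteq> 0" by blast
    then show ?case by (simp add: less_le)
  qed
qed

section \<open>Geometric tail of the hitting time\<close>

definition edges :: "('a \<times> 'a) set" where
  "edges = {(s, t). s \<in> S \<and> t \<in> S \<and> pmf (T s) t > 0}"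

lemma edges_subset: "edges \<subseteq> S \<times> S"
  by (auto simp: edges_def)

text \<open>A shortest path would have fewer than \<open>card S\<close> steps. Counting edges is
  cruder but immediate for a finite relation, and it affects only the constants.\<close>

lemma edges_rtrancl_bounded:
  assumes "(s, t) \<in> edges\<^sup>*"
  shows "\<exists>l y. l \<le> (card S)\<^sup>2 \<and> y 0 = s \<and> y l = t \<and> (\<forall>j<l. (y j, y (Suc j)) \<in> edges)"
proof -
  have "finite edges"
    using edges_subset finite_S finite_subset by blast
  with assms obtain l where l: "l \<le> card edges" "(s, t) \<in> edges ^^ l"
    by (auto simp: rtrancl_finite_eq_relpow)
  moreover have "card edges \<le> (card S)\<^sup>2"
    using card_mono[OF _ edges_subset] finite_S by (simp add: card_cartesian_product power2_eq_square)
  ultimately show ?thesis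
    by (auto simp: relpow_fun_conv intro: le_trans)
qed

text \<open>The run itself supplies the path: if it is in \<open>s\<close> at time \<open>i\<close>,
  has avoided \<open>G\<close> before and visits \<open>G\<close> at time \<open>j\<close>, then
  \<open>i \<le> j\<close>, and its segment from \<open>i\<close> to \<open>j\<close> almost surely
  consists of edges. Without such a path the event is therefore null.\<close>

lemma goal_reachable:
  assumes hits: "AE \<pi> in path_measure T sI. \<exists>j. \<pi> j \<in> G"
    and pos: "path.prob {\<pi>. (\<forall>j<i. \<pi> j \<notin> G) \<and> \<pi> i = s} > 0"
  shows "\<exists>t\<in>G. (s, t) \<in> edges\<^sup>*"
proof (rule ccontr)
  assume no: "\<not> ?thesis"
  have "AE \<pi> in path_measure T sI. \<pi> \<notin> {\<pi>. (\<forall>j<i. \<pi> j \<notin> G) \<and> \<pi> i = s}"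
    using hits AE_path_in_S AE_path_step
  proof eventually_elim
    case (elim \<pi>)
    then obtain j where j: "\<pi> j \<in> G" by blast
    have "(\<pi> i, \<pi> (i + k)) \<in> edges\<^sup>*" for k
    proof (induction k)
      case (Suc k)
      have "(\<pi> (i + k), \<pi> (i + Suc k)) \<in> edges"
        using elim by (simp add: edges_def)
      with Suc show ?case by (rule rtrancl_into_rtrancl)
    qed simp
    from this[of "j - i"] j no show ?case
      by (cases "j < i") auto
  qed
  then have "path.prob {\<pi>. (\<forall>j<i. \<pi> j \<notin> G) \<and> \<pi> i = s} = 0"
    by (intro path.prob_eq_0[THEN iffD2] path_sets_Collect) measurable
  with pos show False by simp
qed

lemma p_min_le:
  assumes "(s, t) \<in> edges"
  shows "p_min S T \<le> pmf (T s) t"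
proof -
  have "finite {pmf (T s) s' | s s'. s \<in> S \<and> s' \<in> S}"
    using finite_S by (intro finite_image_set2) auto
  then show ?thesis
    unfolding p_min_def using assms by (intro Min_le) (auto simp: edges_def)
qed

text \<open>The support of \<open>T sI\<close> is nonempty, so there is an edge whose probability is
  at least \<open>p_min S T\<close>.\<close>

lemma p_min_le_1: "p_min S T \<le> 1"
proof -
  obtain t where "t \<in> set_pmf (T sI)"
    using set_pmf_not_empty by fast
  then have "(sI, t) \<in> edges"
    using T_closed[OF sI_in_S] sI_in_S by (auto simp: edges_def pmf_positive_iff)
  from p_min_le[OF this] pmf_le_1 show ?thesis
    by (rule order_trans)
qed

text \<open>Inside \<open>?A\<close>, the event \<open>?H\<close> of following a fixed path from
  \<open>s\<close> to \<open>G\<close> has at least the share \<open>p ^ L\<close>, and it excludes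
  \<open>?D\<close>, since the path ends in \<open>G\<close> within the \<open>Suc L\<close> times
  of the block. The path depends on \<open>s\<close>, but the factor does not, so the estimate can
  be summed over \<open>s\<close>.\<close>

lemma avoid_block_state:
  assumes hits: "AE \<pi> in path_measure T sI. \<exists>j. \<pi> j \<in> G"
    and p: "0 < p" "p \<le> p_min S T" and L: "(card S)\<^sup>2 \<le> L"
  shows "path.prob {\<pi>. (\<forall>j<i. \<pi> j \<in> S - G) \<and> (\<forall>j\<le>L. \<pi> (i + j) \<notin> G) \<and> \<pi> i = s} \<le>
    (1 - p ^ L) * path.prob {\<pi>. (\<forall>j<i. \<pi> j \<in> S - G) \<and> \<pi> i = s}"
    (is "path.prob ?D \<le> (1 - p ^ L) * path.prob ?A")
proof (cases "path.prob ?A = 0")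
  \<comment> \<open>Here \<open>s\<close> may have no path to \<open>G\<close>, but both sides are
    0.\<close>
  case True
  have "path.prob ?D \<le> path.prob ?A"
    by (rule prob_path_mono, measurable) auto
  with True show ?thesis by simp
next
  case False
  then have "0 < path.prob ?A"
    by (simp add: less_le)
  also have "path.prob ?A \<le> path.prob {\<pi>. (\<forall>j<i. \<pi> j \<notin> G) \<and> \<pi> i = s}"
    by (rule prob_path_mono, measurable) auto
  finally obtain t where t: "t \<in> G" "(s, t) \<in> edges\<^sup>*"
    using goal_reachable[OF hits] by blast
  then obtain l y where ly: "l \<le> (card S)\<^sup>2" "y 0 = s" "y l = t" "\<And>j. j < l \<Longrightarrow> (y j, y (Suc j)) \<in> edges"
    using edges_rtrancl_bounded by metis
  define B where "B j = (if j < i then S - G else {s})" for j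
  have B_iff: "(\<forall>j\<le>i. \<pi> j \<in> B j) \<longleftrightarrow> (\<forall>j<i. \<pi> j \<in> S - G) \<and> \<pi> i = s" for \<pi>
    by (auto simp: B_def le_less)
  let ?H = "{\<pi>. (\<forall>j<i. \<pi> j \<in> S - G) \<and> \<pi> i = s \<and> (\<forall>j\<le>l. \<pi> (i + j) = y j)}"
  have "path.prob {\<pi>. (\<forall>j\<le>i. \<pi> j \<in> B j) \<and> (\<forall>j\<le>l. \<pi> (i + j) = y j)} =
    (\<Prod>j<l. pmf (T (y j)) (y (Suc j))) * path.prob {\<pi>. (\<forall>j\<le>i. \<pi> j \<in> B j) \<and> \<pi> i = y 0}"
    by (rule path_measure_extend) (use finite_S in \<open>auto simp: B_def\<close>)
  then have H: "path.prob ?H = (\<Prod>j<l. pmf (T (y j)) (y (Suc j))) * path.prob ?A"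
    unfolding B_iff by (simp add: ly(2) conj_assoc)
  have p1: "p \<le> 1"
    using p p_min_le_1 by simp
  \<comment> \<open>Replaces the length \<open>l\<close> of the individual path by the common bound
    \<open>L\<close>; this uses \<open>p \<le> 1\<close>.\<close>
  have "p ^ L \<le> p ^ l"
    using p p1 ly(1) L by (intro power_decreasing) auto
  also have "p ^ l = (\<Prod>j<l. p)"
    by simp
  also have "\<dots> \<le> (\<Prod>j<l. pmf (T (y j)) (y (Suc j)))"
    using p p_min_le[OF ly(4)] by (intro prod_mono) (auto intro: order_trans)
  finally have "p ^ L * path.prob ?A \<le> path.prob ?H"
    unfolding H by (rule mult_right_mono) simp
  moreover have "path.prob ?D + path.prob ?H = path.prob (?D \<union> ?H)"
  proof (rule path.finite_measure_Union[symmetric])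
    show "?D \<in> path.events"
      by (rule path_sets_Collect) measurable
    show "?H \<in> path.events"
      by (rule path_sets_Collect) measurable
    show "?D \<inter> ?H = {}"
    proof -
      have "\<pi> \<notin> ?H" if "\<pi> \<in> ?D" for \<pi>
      proof
        assume "\<pi> \<in> ?H"
        then have "\<pi> (i + l) = y l" by blast
        moreover have "l \<le> L" using ly(1) L by simp
        ultimately show False using that t(1) ly(3) by auto
      qed
      then show ?thesis by blast
    qed
  qed
  moreover have "path.prob (?D \<union> ?H) \<le> path.prob ?A"
    unfolding Collect_disj_eq[symmetric] by (rule prob_path_mono, measurable) auto
  ultimately show ?thesis
    by (simp add: algebra_simps)
qed

lemma avoid_block:
  assumes hits: "AE \<pi> in path_measure T sI. \<exists>j. \<pi> j \<in> G"
    and p: "0 < p" "p \<le> p_min S T" and L: "(card S)\<^sup>2 \<le> L"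
  shows "path.prob {\<pi>. \<forall>j<i + Suc L. \<pi> j \<notin> G} \<le> (1 - p ^ L) * path.prob {\<pi>. \<forall>j<i. \<pi> j \<notin> G}"
proof -
  let ?Q = "\<lambda>\<pi>. \<forall>j<i. \<pi> j \<in> S - G"
  let ?R = "\<lambda>\<pi>. \<forall>j\<le>L. \<pi> (i + j) \<notin> G"
  have iff: "(\<forall>j<i + Suc L. \<pi> j \<notin> G) \<longleftrightarrow> (\<forall>j<i. \<pi> j \<notin> G) \<and> ?R \<pi>" for \<pi>
  proof safe
    fix j assume *: "\<forall>j<i. \<pi> j \<notin> G" "?R \<pi>" and "j < i + Suc L" "\<pi> j \<in> G"
    then show False
      using *(1)[rule_format, of j] *(2)[rule_format, of "j - i"] by (cases "j < i") (auto simp: le_diff_conv)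
  qed auto
  have "path.prob {\<pi>. \<forall>j<i + Suc L. \<pi> j \<notin> G} = path.prob {\<pi>. (?Q \<pi> \<and> ?R \<pi>) \<and> \<pi> i \<in> S}"
    \<comment> \<open>Almost surely, avoiding \<open>G\<close> is the same as staying in
      \<open>S - G\<close>, and the state at time \<open>i\<close> is one of finitely many.\<close>
    unfolding iff using AE_path_in_S
    by (intro prob_path_cong_AE, measurable) (auto elim!: eventually_mono)
  also have "\<dots> = (\<Sum>s\<in>S. path.prob {\<pi>. (?Q \<pi> \<and> ?R \<pi>) \<and> \<pi> i = s})"
    by (rule prob_path_split) measurable
  also have "\<dots> \<le> (\<Sum>s\<in>S. (1 - p ^ L) * path.prob {\<pi>. ?Q \<pi> \<and> \<pi> i = s})"
    unfolding conj_assoc by (intro sum_mono avoid_block_state hits p L)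
  also have "\<dots> = (1 - p ^ L) * (\<Sum>s\<in>S. path.prob {\<pi>. ?Q \<pi> \<and> \<pi> i = s})"
    by (rule sum_distrib_left[symmetric])
  also have "(\<Sum>s\<in>S. path.prob {\<pi>. ?Q \<pi> \<and> \<pi> i = s}) = path.prob {\<pi>. ?Q \<pi> \<and> \<pi> i \<in> S}"
    by (rule prob_path_split[symmetric]) measurable
  also have "path.prob {\<pi>. ?Q \<pi> \<and> \<pi> i \<in> S} = path.prob {\<pi>. \<forall>j<i. \<pi> j \<notin> G}"
    using AE_path_in_S
    by (intro prob_path_cong_AE, measurable) (auto elim!: eventually_mono)
  finally show ?thesis .
qed

text \<open>Up to time \<open>i\<close> there is room for \<open>i div Suc L\<close> disjoint
  blocks, and each costs a factor \<open>1 - p ^ L\<close>.\<close>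

lemma avoid_prob_le:
  assumes hits: "AE \<pi> in path_measure T sI. \<exists>j. \<pi> j \<in> G"
    and p: "0 < p" "p \<le> p_min S T" and L: "(card S)\<^sup>2 \<le> L"
  shows "path.prob {\<pi>. \<forall>j<i. \<pi> j \<notin> G} \<le> (1 - p ^ L) ^ (i div Suc L)"
proof -
  have "p ^ L \<le> 1"
    using p p_min_le_1 by (intro power_le_one) auto
  then have "path.prob {\<pi>. \<forall>j<m * Suc L. \<pi> j \<notin> G} \<le> (1 - p ^ L) ^ m" for m
  proof (induction m)
    case (Suc m)
    have "path.prob {\<pi>. \<forall>j<Suc m * Suc L. \<pi> j \<notin> G} \<le>
        (1 - p ^ L) * path.prob {\<pi>. \<forall>j<m * Suc L. \<pi> j \<notin> G}"
      using avoid_block[OF hits p L, of "m * Suc L"] by (simp only: mult_Suc add.commute)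
    also have "\<dots> \<le> (1 - p ^ L) * (1 - p ^ L) ^ m"
      using Suc by (intro mult_left_mono) auto
    finally show ?case by simp
  qed simp
  moreover have "path.prob {\<pi>. \<forall>j<i. \<pi> j \<notin> G} \<le> path.prob {\<pi>. \<forall>j<i div Suc L * Suc L. \<pi> j \<notin> G}"
    by (rule prob_path_mono, measurable) (use div_times_less_eq_dividend[of i "Suc L"] in \<open>auto intro: less_le_trans\<close>)
  ultimately show ?thesis
    by (rule order_trans[rotated])
qed

end

section \<open>Chebyshev's inequality for the mean of independent samples\<close>

text \<open>The bound \<open>V\<close> on the raw second moment also bounds the variance. For the
  centred variable \<open>D\<close>, independence makes the mixed terms vanish, so the squared sum
  has expectation at most \<open>real k * V\<close>.\<close>

lemma (in prob_space) sample_mean_Chebyshev: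
  fixes X :: "'a \<Rightarrow> real"
  assumes X [measurable]: "random_variable borel X" and int2: "integrable M (\<lambda>x. (X x)\<^sup>2)"
    and V: "expectation (\<lambda>x. (X x)\<^sup>2) \<le> V" and k: "0 < k" and \<epsilon>: "0 < \<epsilon>"
  shows "1 - V / (real k * \<epsilon>\<^sup>2) \<le> measure (PiM {..<k} (\<lambda>_. M))
    {\<omega> \<in> space (PiM {..<k} (\<lambda>_. M)). \<bar>(\<Sum>j<k. X (\<omega> j)) / real k - expectation X\<bar> \<le> \<epsilon>}"
proof -
  have M: "prob_space M"
    by (rule prob_space_axioms)
  let ?P = "PiM {..<k} (\<lambda>_. M)"
  define D where "D x = X x - expectation X" for x
  have int: "integrable M X"
    by (rule square_integrable_imp_integrable[OF X int2])
  have D_meas [measurable]: "D \<in> borel_measurable M"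
    unfolding D_def by measurable
  have int_D: "integrable M D"
    unfolding D_def using int by simp
  have D0: "expectation D = 0"
    unfolding D_def using int by (simp add: prob_space)
  have int_D2: "integrable M (\<lambda>x. (D x)\<^sup>2)"
    unfolding D_def power2_diff using int int2 by simp
  have ED2: "expectation (\<lambda>x. (D x)\<^sup>2) \<le> V"
    using V variance_eq[OF int int2] unfolding D_def by (simp add: order_trans[OF _ V])
  interpret P: prob_space ?P
    by (intro prob_space_PiM M)
  interpret product: product_prob_space "\<lambda>_. M" "{..<k}" ..
  have corr: "integrable ?P (\<lambda>\<omega>. D (\<omega> i) * D (\<omega> j)) \<and>
      P.expectation (\<lambda>\<omega>. D (\<omega> i) * D (\<omega> j)) = (if i = j then expectation (\<lambda>x. (D x)\<^sup>2) else 0)"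
    if "i < k" "j < k" for i j
  proof (cases "i = j")
    case True
    \<comment> \<open>Padding with the constant 1 turns the term into a product over all
      coordinates, whose integral factorises. On the diagonal both factors share a coordinate, hence
      the square.\<close>
    let ?f = "\<lambda>n. if n = i then (\<lambda>x. (D x)\<^sup>2) else (\<lambda>_. 1)"
    have prod: "(\<Prod>n<k. ?f n (\<omega> n)) = D (\<omega> i) * D (\<omega> j)" for \<omega>
    proof -
      have "(\<Prod>n<k. ?f n (\<omega> n)) = (\<Prod>n<k. if n = i then (D (\<omega> i))\<^sup>2 else 1)"
        by (intro prod.cong) auto
      also have "\<dots> = D (\<omega> i) * D (\<omega> j)"
        using that True by (simp add: power2_eq_square)
      finally show ?thesis .
    qed
    have int_f: "integrable M (?f n)" for n
      using int_D2 by simp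
    have "(\<Prod>n<k. expectation (?f n)) = (\<Prod>n<k. if n = i then expectation (\<lambda>x. (D x)\<^sup>2) else 1)"
      by (intro prod.cong) (auto simp: prob_space)
    also have "\<dots> = expectation (\<lambda>x. (D x)\<^sup>2)"
      using that by simp
    finally show ?thesis
      using product.product_integrable_prod[of "{..<k}" ?f, OF _ int_f]
        product.product_integral_prod[of "{..<k}" ?f, OF _ int_f] True
      unfolding prod by simp
  next
    case False
    let ?f = "\<lambda>n. if n = i \<or> n = j then D else (\<lambda>_. 1)"
    have prod: "(\<Prod>n<k. ?f n (\<omega> n)) = D (\<omega> i) * D (\<omega> j)" for \<omega>
    proof -
      have "(\<Prod>n<k. ?f n (\<omega> n)) = (\<Prod>n<k. (if n = i then D (\<omega> i) else 1) * (if n = j then D (\<omega> j) else 1))"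
        using False by (intro prod.cong) auto
      also have "\<dots> = D (\<omega> i) * D (\<omega> j)"
        using that by (simp add: prod.distrib)
      finally show ?thesis .
    qed
    have int_f: "integrable M (?f n)" for n
      using int_D by simp
    have "(\<Prod>n<k. expectation (?f n)) = 0"
      using that D0 by (intro prod_zero bexI[of _ i]) auto
    then show ?thesis
      using product.product_integrable_prod[of "{..<k}" ?f, OF _ int_f]
        product.product_integral_prod[of "{..<k}" ?f, OF _ int_f] False
      unfolding prod by simp
  qed
  define F where "F \<omega> = (\<Sum>j<k. D (\<omega> j))" for \<omega>
  have F_meas [measurable]: "F \<in> borel_measurable ?P"
    unfolding F_def by measurable
  have F2: "(F \<omega>)\<^sup>2 = (\<Sum>i<k. \<Sum>j<k. D (\<omega> i) * D (\<omega> j))" for \<omega>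
    by (simp add: F_def power2_eq_square sum_product)
  have int_F2: "integrable ?P (\<lambda>\<omega>. (F \<omega>)\<^sup>2)"
    unfolding F2 using corr by (intro Bochner_Integration.integrable_sum) auto
  have "P.expectation (\<lambda>\<omega>. (F \<omega>)\<^sup>2) = (\<Sum>i<k. \<Sum>j<k. P.expectation (\<lambda>\<omega>. D (\<omega> i) * D (\<omega> j)))"
    unfolding F2 using corr
    by (subst Bochner_Integration.integral_sum, force intro!: Bochner_Integration.integrable_sum)
      (auto intro!: sum.cong Bochner_Integration.integral_sum)
  also have "\<dots> = (\<Sum>i<k. \<Sum>j<k. if i = j then expectation (\<lambda>x. (D x)\<^sup>2) else 0)"
    using corr by (intro sum.cong) auto
  also have "\<dots> = real k * expectation (\<lambda>x. (D x)\<^sup>2)"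
    by simp
  also have "\<dots> \<le> real k * V"
    using ED2 by (intro mult_left_mono) auto
  finally have EF2: "P.expectation (\<lambda>\<omega>. (F \<omega>)\<^sup>2) \<le> real k * V" .
  \<comment> \<open>\<open>F\<close> is \<open>k\<close> times the deviation of the sample mean, so
    the threshold is scaled by \<open>k\<close> as well.\<close>
  have "P.prob {\<omega> \<in> space ?P. real k * \<epsilon> \<le> \<bar>F \<omega>\<bar>} \<le> P.expectation (\<lambda>\<omega>. (F \<omega>)\<^sup>2) / (real k * \<epsilon>)\<^sup>2"
    using k \<epsilon> by (intro P.second_moment_method int_F2) (auto simp: F_meas)
  also have "\<dots> \<le> (real k * V) / (real k * \<epsilon>)\<^sup>2"
    by (intro divide_right_mono EF2) simp
  also have "\<dots> = V / (real k * \<epsilon>\<^sup>2)"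
    using k by (simp add: power2_eq_square)
  finally have "1 - V / (real k * \<epsilon>\<^sup>2) \<le> 1 - P.prob {\<omega> \<in> space ?P. real k * \<epsilon> \<le> \<bar>F \<omega>\<bar>}"
    by simp
  also have "\<dots> = P.prob (space ?P - {\<omega> \<in> space ?P. real k * \<epsilon> \<le> \<bar>F \<omega>\<bar>})"
    by (intro P.prob_compl[symmetric]) measurable
  also have "\<dots> \<le> P.prob {\<omega> \<in> space ?P. \<bar>(\<Sum>j<k. X (\<omega> j)) / real k - expectation X\<bar> \<le> \<epsilon>}"
  proof (intro P.finite_measure_mono subsetI)
    fix \<omega> assume \<omega>: "\<omega> \<in> space ?P - {\<omega> \<in> space ?P. real k * \<epsilon> \<le> \<bar>F \<omega>\<bar>}"
    have "F \<omega> = real k * ((\<Sum>j<k. X (\<omega> j)) / real k - expectation X)"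
      using k by (simp add: F_def D_def sum_subtractf field_simps)
    with \<omega> k show "\<omega> \<in> {\<omega> \<in> space ?P. \<bar>(\<Sum>j<k. X (\<omega> j)) / real k - expectation X\<bar> \<le> \<epsilon>}"
      by (auto simp: abs_mult not_le)
  qed measurable
  finally show ?thesis .
qed

section \<open>Geometric decay, and the reward of a single run\<close>

text \<open>Turns decay per block into decay per step, so that a power series can be summed later.
  The rate \<open>c\<close> is an \<open>N\<close>-th root, and \<open>C\<close> pays for the
  incomplete last block.\<close>

lemma power_div_le_geometric:
  fixes q :: real
  assumes "0 \<le> q" "q < 1" "0 < N"
  obtains C c where "0 \<le> C" "0 \<le> c" "c < 1" "\<And>i. q ^ (i div N) \<le> C * c ^ i"
proof -
  \<comment> \<open>The maximum keeps \<open>1 / \<rho>\<close> meaningful when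
    \<open>q = 0\<close>, which happens for \<open>p = 1\<close>.\<close>
  define \<rho> where "\<rho> = max q (1 / 2)"
  have \<rho>: "0 < \<rho>" "\<rho> < 1" "q \<le> \<rho>"
    using assms by (auto simp: \<rho>_def)
  define c where "c = root N \<rho>"
  have c: "0 < c" "c < 1" "c ^ N = \<rho>"
    using \<rho> assms by (auto simp: c_def real_root_pow_pos2)
  have "q ^ (i div N) \<le> 1 / \<rho> * c ^ i" for i
  proof -
    have "i \<le> N * Suc (i div N)"
      using dividend_less_times_div[of N i] assms by simp
    then have "c ^ (N * Suc (i div N)) \<le> c ^ i"
      using c by (intro power_decreasing) auto
    then have "\<rho> * \<rho> ^ (i div N) \<le> c ^ i"
      unfolding power_mult c(3) by simp
    moreover have "q ^ (i div N) \<le> \<rho> ^ (i div N)"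
      using assms \<rho> by (intro power_mono) auto
    ultimately show ?thesis
      using \<rho> by (auto simp: field_simps intro: order_trans[rotated])
  qed
  with that[of "1 / \<rho>" c] \<rho> c show thesis
    by simp
qed

text \<open>Replaces the infimum by conditions on single coordinates, which makes measurability
  automatic and links \<open>path_reward\<close> to the avoidance events.\<close>

lemma enat_le_idx_iff: "enat i \<le> idx \<pi> G \<longleftrightarrow> (\<forall>j<i. \<pi> j \<notin> G)"
proof -
  have "enat i \<le> idx \<pi> G \<longleftrightarrow> (\<forall>j. \<pi> j \<in> G \<longrightarrow> i \<le> j)"
    by (auto simp: idx_def le_Inf_iff)
  then show ?thesis
    by (auto simp: not_less[symmetric])
qed

lemma idx_eq_infinity_iff: "idx \<pi> G = \<infinity> \<longleftrightarrow> (\<forall>j. \<pi> j \<notin> G)"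
proof
  assume "idx \<pi> G = \<infinity>"
  then have "enat (Suc j) \<le> idx \<pi> G" for j by simp
  then show "\<forall>j. \<pi> j \<notin> G" unfolding enat_le_idx_iff by blast
qed (simp add: idx_def top_enat_def[symmetric])

lemma path_reward_eq_sum:
  assumes "\<pi> t \<in> G" "\<And>j. j < t \<Longrightarrow> \<pi> j \<notin> G"
  shows "path_reward R G \<pi> = (\<Sum>i\<le>t. ennreal (R (\<pi> i)))"
proof -
  have "(\<forall>j<i. \<pi> j \<notin> G) \<longleftrightarrow> i \<le> t" for i
    using assms by (meson less_le_trans not_le)
  then have "path_reward R G \<pi> = (\<Sum>i. if i \<le> t then ennreal (R (\<pi> i)) else 0)"
    unfolding path_reward_def enat_le_idx_iff by simp
  also have "\<dots> = (\<Sum>i\<le>t. ennreal (R (\<pi> i)))"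
    by (subst suminf_finite[of "{..t}"]) auto
  finally show ?thesis .
qed

lemma measurable_path_reward [measurable]:
  "path_reward R G \<in> borel_measurable (path_measure T sI)"
proof -
  have [measurable]: "(\<lambda>\<pi>. ennreal (R (\<pi> i))) \<in> borel_measurable (path_measure T sI)" for i
    by (rule measurable_compose[OF measurable_path_component]) simp
  show ?thesis
    unfolding path_reward_def enat_le_idx_iff by measurable
qed

section \<open>Moments of the path reward\<close>

context dtmc
begin

interpretation path: prob_space "path_measure T sI"
  by (rule prob_space_path_measure)

text \<open>This rests on the convention in \<open>reach_reward\<close>: the integral alone could be
  finite although \<open>G\<close> is missed, for instance when all rewards are 0.\<close>

lemma AE_hits:
  assumes "reach_reward R T sI G < \<infinity>"
  shows "AE \<pi> in path_measure T sI. \<exists>j. \<pi> j \<in> G"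
proof -
  have "emeasure (path_measure T sI) {\<pi>. idx \<pi> G = \<infinity>} = 0"
    using assms by (auto simp: reach_reward_def split: if_splits)
  moreover have "{\<pi>. idx \<pi> G = \<infinity>} \<in> path.events"
    unfolding idx_eq_infinity_iff by (intro path_sets_Collect) measurable
  ultimately show ?thesis
    by (intro AE_I'[of "{\<pi>. idx \<pi> G = \<infinity>}"]) (auto simp: idx_eq_infinity_iff)
qed

text \<open>With first visit at time \<open>t\<close>, exactly \<open>Suc t\<close> rewards are
  collected, as the goal state counts.\<close>

lemma AE_path_reward_le:
  assumes hits: "AE \<pi> in path_measure T sI. \<exists>j. \<pi> j \<in> G" and r: "r_max S R \<le> r" "0 \<le> r"
  shows "AE \<pi> in path_measure T sI. \<exists>t. \<pi> t \<in> G \<and> (\<forall>j<t. \<pi> j \<notin> G) \<and>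
    path_reward R G \<pi> \<le> ennreal (r * real (Suc t))"
  using hits AE_path_in_S
proof eventually_elim
  case (elim \<pi>)
  define t where "t = (LEAST j. \<pi> j \<in> G)"
  have t: "\<pi> t \<in> G" "\<And>j. j < t \<Longrightarrow> \<pi> j \<notin> G"
    using elim(1) unfolding t_def by (auto intro: LeastI_ex dest: not_less_Least)
  have "R (\<pi> i) \<le> r" for i
    using elim(2) finite_S r(1) by (auto simp: r_max_def intro: order_trans[OF Max_ge])
  then have "(\<Sum>i\<le>t. ennreal (R (\<pi> i))) \<le> (\<Sum>i\<le>t. ennreal r)"
    by (intro sum_mono ennreal_leI) auto
  also have "\<dots> = ennreal (r * real (Suc t))"
    using r(2) by (subst sum_ennreal) (auto simp: mult.commute)
  finally show ?case
    using t path_reward_eq_sum[of \<pi> t G R] by auto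
qed

text \<open>A tail-sum argument for the second moment: the square of \<open>Suc t\<close> is bounded
  by a sum of weights over \<open>i \<le> t\<close>, and \<open>i \<le> t\<close> means that
  \<open>G\<close> is avoided before time \<open>i\<close>. Integration then leaves only avoidance
  probabilities.\<close>

lemma path_reward_second_moment:
  assumes hits: "AE \<pi> in path_measure T sI. \<exists>j. \<pi> j \<in> G" and r: "r_max S R \<le> r" "0 \<le> r"
    and avoid: "\<And>i. path.prob {\<pi>. \<forall>j<i. \<pi> j \<notin> G} \<le> C * c ^ i"
    and C: "0 \<le> C" and c: "0 \<le> c" "c < 1"
  shows "(\<integral>\<^sup>+\<pi>. (path_reward R G \<pi>)\<^sup>2 \<partial>path_measure T sI) \<le> ennreal (2 * r\<^sup>2 * C / (1 - c)\<^sup>2)"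
proof -
  let ?D = "\<lambda>i. {\<pi>. \<forall>j<i. \<pi> j \<notin> G}"
  \<comment> \<open>Chosen so that the weights up to \<open>t\<close> add up to
    \<open>r\<^sup>2\<close> times (t+1)(t+2), which dominates the squared reward bound.\<close>
  let ?a = "\<lambda>i. 2 * r\<^sup>2 * real (Suc i)"
  have [measurable]: "?D i \<in> path.events" for i
    by (rule path_sets_Collect) measurable
  have gauss: "(\<Sum>i\<le>t. ?a i) = r\<^sup>2 * (real (Suc t) * real (Suc (Suc t)))" for t
    by (induction t) (auto simp: algebra_simps)
  have "AE \<pi> in path_measure T sI. (path_reward R G \<pi>)\<^sup>2 \<le> (\<Sum>i. ennreal (?a i) * indicator (?D i) \<pi>)"
    using AE_path_reward_le[OF hits r]
  proof eventually_elim
    case (elim \<pi>)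
    then obtain t where t: "\<pi> t \<in> G" "\<forall>j<t. \<pi> j \<notin> G" "path_reward R G \<pi> \<le> ennreal (r * real (Suc t))"
      by blast
    have "(path_reward R G \<pi>)\<^sup>2 \<le> (ennreal (r * real (Suc t)))\<^sup>2"
      using t(3) by (intro power_mono) auto
    also have "\<dots> = ennreal (r\<^sup>2 * (real (Suc t))\<^sup>2)"
      using r(2) by (subst ennreal_power) (auto simp: power_mult_distrib)
    also have "\<dots> \<le> ennreal (\<Sum>i\<le>t. ?a i)"
      unfolding gauss by (intro ennreal_leI mult_left_mono) (auto simp: power2_eq_square)
    also have "\<dots> = (\<Sum>i\<le>t. ennreal (?a i))"
      by (rule sum_ennreal[symmetric]) simp
    also have "\<dots> = (\<Sum>i\<le>t. ennreal (?a i) * indicator (?D i) \<pi>)"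
      using t(2) by (intro sum.cong) auto
    also have "\<dots> \<le> (\<Sum>i. ennreal (?a i) * indicator (?D i) \<pi>)"
      by (rule sum_le_suminf) auto
    finally show ?case .
  qed
  then have "(\<integral>\<^sup>+\<pi>. (path_reward R G \<pi>)\<^sup>2 \<partial>path_measure T sI) \<le>
      (\<integral>\<^sup>+\<pi>. (\<Sum>i. ennreal (?a i) * indicator (?D i) \<pi>) \<partial>path_measure T sI)"
    by (rule nn_integral_mono_AE)
  also have "\<dots> = (\<Sum>i. \<integral>\<^sup>+\<pi>. ennreal (?a i) * indicator (?D i) \<pi> \<partial>path_measure T sI)"
    by (rule nn_integral_suminf) measurable
  also have "\<dots> = (\<Sum>i. ennreal (?a i) * emeasure (path_measure T sI) (?D i))"
    by (intro suminf_cong nn_integral_cmult_indicator) measurable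
  also have "\<dots> = (\<Sum>i. ennreal (?a i * path.prob (?D i)))"
    by (simp add: path.emeasure_eq_measure ennreal_mult del: of_nat_Suc)
  also have "\<dots> \<le> (\<Sum>i. ennreal (2 * r\<^sup>2 * C * (real (Suc i) * c ^ i)))"
  proof (intro suminf_le ennreal_leI summableI)
    fix i
    have "?a i * path.prob (?D i) \<le> ?a i * (C * c ^ i)"
      by (intro mult_left_mono avoid) simp
    then show "?a i * path.prob (?D i) \<le> 2 * r\<^sup>2 * C * (real (Suc i) * c ^ i)"
      by (simp add: mult_ac)
  qed
  \<comment> \<open>The differentiated geometric series.\<close>
  also have "\<dots> = ennreal (2 * r\<^sup>2 * C * (1 / (1 - c)\<^sup>2))"
    using C c geometric_deriv_sums[of c]
    by (intro suminf_ennreal_eq sums_mult) auto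
  finally show ?thesis by simp
qed

text \<open>Passes from \<open>ennreal\<close> to real integrals. \<open>enn2real\<close> sends
  infinity to 0, but this alters the reward only on a null set.\<close>

lemma path_reward_moments:
  assumes finite: "reach_reward R T sI G < \<infinity>" and r: "r_max S R \<le> r" "0 \<le> r"
    and V: "(\<integral>\<^sup>+\<pi>. (path_reward R G \<pi>)\<^sup>2 \<partial>path_measure T sI) \<le> ennreal V" "0 \<le> V"
  defines "X \<equiv> \<lambda>\<pi>. enn2real (path_reward R G \<pi>)"
  shows "integrable (path_measure T sI) (\<lambda>\<pi>. (X \<pi>)\<^sup>2)"
    and "path.expectation (\<lambda>\<pi>. (X \<pi>)\<^sup>2) \<le> V"
    and "path.expectation X = enn2real (reach_reward R T sI G)"
proof -
  have [measurable]: "X \<in> borel_measurable (path_measure T sI)"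
    unfolding X_def by measurable
  have "AE \<pi> in path_measure T sI. path_reward R G \<pi> < \<infinity>"
    using AE_path_reward_le[OF AE_hits[OF finite] r]
    by eventually_elim (auto intro: le_less_trans)
  then have X: "AE \<pi> in path_measure T sI. ennreal (X \<pi>) = path_reward R G \<pi>"
    by eventually_elim (simp add: X_def)
  have "(\<integral>\<^sup>+\<pi>. ennreal ((X \<pi>)\<^sup>2) \<partial>path_measure T sI) = (\<integral>\<^sup>+\<pi>. (path_reward R G \<pi>)\<^sup>2 \<partial>path_measure T sI)"
  proof (rule nn_integral_cong_AE)
    show "AE \<pi> in path_measure T sI. ennreal ((X \<pi>)\<^sup>2) = (path_reward R G \<pi>)\<^sup>2"
      using X
    proof eventually_elim
      case (elim \<pi>)
      have "ennreal ((X \<pi>)\<^sup>2) = (ennreal (X \<pi>))\<^sup>2"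
        by (simp add: ennreal_power X_def)
      with elim show ?case by simp
    qed
  qed
  with V have le: "(\<integral>\<^sup>+\<pi>. ennreal ((X \<pi>)\<^sup>2) \<partial>path_measure T sI) \<le> ennreal V"
    by simp
  then show "integrable (path_measure T sI) (\<lambda>\<pi>. (X \<pi>)\<^sup>2)"
    by (intro integrableI_bounded) (auto intro: le_less_trans)
  have "path.expectation (\<lambda>\<pi>. (X \<pi>)\<^sup>2) = enn2real (\<integral>\<^sup>+\<pi>. ennreal ((X \<pi>)\<^sup>2) \<partial>path_measure T sI)"
    by (rule integral_eq_nn_integral) auto
  also have "\<dots> \<le> V"
    using le V(2) by (rule enn2real_leI[rotated])
  finally show "path.expectation (\<lambda>\<pi>. (X \<pi>)\<^sup>2) \<le> V" .
  have "path.expectation X = enn2real (\<integral>\<^sup>+\<pi>. ennreal (X \<pi>) \<partial>path_measure T sI)"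
    by (rule integral_eq_nn_integral) (auto simp: X_def)
  also have "(\<integral>\<^sup>+\<pi>. ennreal (X \<pi>) \<partial>path_measure T sI) = (\<integral>\<^sup>+\<pi>. path_reward R G \<pi> \<partial>path_measure T sI)"
    by (rule nn_integral_cong_AE) (rule X)
  also have "\<dots> = reach_reward R T sI G"
    using finite by (auto simp: reach_reward_def split: if_splits)
  finally show "path.expectation X = enn2real (reach_reward R T sI G)" .
qed

end

section \<open>The number of runs and the PAC guarantee\<close>

text \<open>The point is the order of the quantifiers: \<open>V\<close> is fixed before the chain.
  All chains share the block parameter \<open>n\<^sup>2\<close>, since
  \<open>card S \<le> n\<close>.\<close>

lemma uniform_second_moment_bound:
  fixes n :: nat and p r :: real
  assumes p: "0 < p" "p \<le> 1" and r: "0 \<le> r"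
  obtains V where "0 \<le> V"
    and "\<And>(S :: 'a set) R T sI G. dtmc S R T sI \<Longrightarrow> reach_reward R T sI G < \<infinity> \<Longrightarrow> card S \<le> n \<Longrightarrow>
      p \<le> p_min S T \<Longrightarrow> r_max S R \<le> r \<Longrightarrow>
      (\<integral>\<^sup>+\<pi>. (path_reward R G \<pi>)\<^sup>2 \<partial>path_measure T sI) \<le> ennreal V"
proof -
  have q: "0 \<le> 1 - p ^ n\<^sup>2" "1 - p ^ n\<^sup>2 < 1"
    using p by (auto simp: power_le_one)
  obtain C c where Cc: "0 \<le> C" "0 \<le> c" "c < 1" "\<And>i. (1 - p ^ n\<^sup>2) ^ (i div Suc (n\<^sup>2)) \<le> C * c ^ i"
    using power_div_le_geometric[OF q, of "Suc (n\<^sup>2)"] by auto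
  show thesis
  proof (rule that)
    show "0 \<le> 2 * r\<^sup>2 * C / (1 - c)\<^sup>2"
      using Cc by simp
    fix S :: "'a set" and R T sI G
    assume "dtmc S R T sI"
    then interpret dtmc S R T sI .
    assume finite: "reach_reward R T sI G < \<infinity>" and bounds: "card S \<le> n" "p \<le> p_min S T" "r_max S R \<le> r"
    have "measure (path_measure T sI) {\<pi>. \<forall>j<i. \<pi> j \<notin> G} \<le> C * c ^ i" for i
      using avoid_prob_le[OF AE_hits[OF finite] p(1) bounds(2), of "n\<^sup>2" i] bounds(1) Cc(4)[of i]
      by (simp add: power_mono)
    then show "(\<integral>\<^sup>+\<pi>. (path_reward R G \<pi>)\<^sup>2 \<partial>path_measure T sI) \<le> ennreal (2 * r\<^sup>2 * C / (1 - c)\<^sup>2)"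
      using Cc by (intro path_reward_second_moment AE_hits finite bounds r)
  qed
qed

definition mean_reward :: "'a observation list \<Rightarrow> real" where
  "mean_reward obs = (\<Sum>ob\<leftarrow>obs. enn2real (fst (snd ob))) / real (length obs)"

lemma mean_reward_observe:
  "mean_reward (map (\<lambda>j. observe R G (\<omega> j)) [0..<k]) =
    (\<Sum>j<k. enn2real (path_reward R G (\<omega> j))) / real k"
  by (simp add: mean_reward_def observe_def comp_def interv_sum_list_conv_sum_set_nat atLeast0LessThan)

lemma PAC_fixed_parameters:
  fixes n :: nat and p r \<gamma> \<epsilon> :: real
  assumes p: "0 < p" and r: "0 \<le> r" and \<gamma>: "0 < \<gamma>" "\<gamma> < 1" and \<epsilon>: "0 < \<epsilon>"
  shows "\<exists>k. \<forall>(S :: 'a set) R T sI G. dtmc S R T sI \<longrightarrow> reach_reward R T sI G < \<infinity> \<longrightarrow>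
      card S \<le> n \<longrightarrow> p \<le> p_min S T \<longrightarrow> r_max S R \<le> r \<longrightarrow>
      \<gamma> \<le> coverage R T sI G k (\<lambda>obs. {mean_reward obs - \<epsilon>..mean_reward obs + \<epsilon>})
        (enn2real (reach_reward R T sI G))"
proof (cases "p \<le> 1")
  case True
  obtain V where V: "0 \<le> V"
    "\<And>(S :: 'a set) R T sI G. dtmc S R T sI \<Longrightarrow> reach_reward R T sI G < \<infinity> \<Longrightarrow> card S \<le> n \<Longrightarrow>
      p \<le> p_min S T \<Longrightarrow> r_max S R \<le> r \<Longrightarrow>
      (\<integral>\<^sup>+\<pi>. (path_reward R G \<pi>)\<^sup>2 \<partial>path_measure T sI) \<le> ennreal V"
    using uniform_second_moment_bound[OF p True r] by blast
  \<comment> \<open>Solves \<open>V / (real k * \<epsilon>\<^sup>2) \<le> 1 - \<gamma>\<close>, the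
    failure probability allowed in Chebyshev's bound. Strictness also forces \<open>k\<close> to be
    positive when \<open>V = 0\<close>.\<close>
  obtain k :: nat where k_gt: "V / (\<epsilon>\<^sup>2 * (1 - \<gamma>)) < real k"
    using reals_Archimedean2 by blast
  have "0 \<le> V / (\<epsilon>\<^sup>2 * (1 - \<gamma>))"
    using V(1) \<gamma> by simp
  with k_gt have "0 < real k" by linarith
  then have k: "0 < k" by simp
  have "V < real k * (\<epsilon>\<^sup>2 * (1 - \<gamma>))"
    using k_gt \<gamma> \<epsilon> by (simp add: pos_divide_less_eq)
  with k have Vk: "V / (real k * \<epsilon>\<^sup>2) \<le> 1 - \<gamma>"
    using \<epsilon> by (simp add: pos_divide_le_eq mult_ac)
  show ?thesis
  proof (intro exI allI impI)
    fix S :: "'a set" and R T sI G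
    assume D: "dtmc S R T sI" "reach_reward R T sI G < \<infinity>" "card S \<le> n" "p \<le> p_min S T" "r_max S R \<le> r"
    interpret dtmc S R T sI by (rule D)
    interpret prob_space "path_measure T sI" by (rule prob_space_path_measure)
    let ?X = "\<lambda>\<pi>. enn2real (path_reward R G \<pi>)"
    let ?x = "enn2real (reach_reward R T sI G)"
    let ?M = "PiM {..<k} (\<lambda>_. path_measure T sI)"
    note moments = path_reward_moments[OF D(2,5) r V(2)[OF D] V(1)]
    have "\<gamma> \<le> 1 - V / (real k * \<epsilon>\<^sup>2)"
      using Vk by simp
    also have "\<dots> \<le> measure ?M {\<omega> \<in> space ?M. \<bar>(\<Sum>j<k. ?X (\<omega> j)) / real k - expectation ?X\<bar> \<le> \<epsilon>}"
      using k \<epsilon> moments by (intro sample_mean_Chebyshev) auto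
    also have "\<dots> = coverage R T sI G k (\<lambda>obs. {mean_reward obs - \<epsilon>..mean_reward obs + \<epsilon>}) ?x"
      unfolding coverage_def Let_def mean_reward_observe moments(3)
      by (intro arg_cong[where f = "measure ?M"]) (auto simp: abs_le_iff)
    finally show "\<gamma> \<le> coverage R T sI G k (\<lambda>obs. {mean_reward obs - \<epsilon>..mean_reward obs + \<epsilon>}) ?x" .
  qed
next
  case False
  \<comment> \<open>No chain has \<open>p_min S T > 1\<close>, so the claim is vacuous and any
    \<open>k\<close> serves.\<close>
  show ?thesis
  proof (intro exI[of _ 0] allI impI)
    fix S :: "'a set" and R T sI and G :: "'a set"
    assume "dtmc S R T sI" "p \<le> p_min S T"
    with dtmc.p_min_le_1[of S R T sI] False
    show "\<gamma> \<le> coverage R T sI G 0 (\<lambda>obs. {mean_reward obs - \<epsilon>..mean_reward obs + \<epsilon>})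
        (enn2real (reach_reward R T sI G))" by simp
  qed
qed

theorem corollary1:
  shows "\<exists>(k :: nat \<Rightarrow> real \<Rightarrow> real \<Rightarrow> real \<Rightarrow> real \<Rightarrow> nat)
          (A :: nat \<Rightarrow> real \<Rightarrow> real \<Rightarrow> real \<Rightarrow> real \<Rightarrow> 'a observation list \<Rightarrow> real set).
    \<forall>(S_bound :: nat) (p_bound :: real) (r_bound :: real) (\<gamma> :: real) (\<epsilon> :: real).
      0 < p_bound \<longrightarrow> 0 \<le> r_bound \<longrightarrow> 0 < \<gamma> \<longrightarrow> \<gamma> < 1 \<longrightarrow> 0 < \<epsilon> \<longrightarrow>
        (\<forall>obs. interval_of_width (2 * \<epsilon>) (A S_bound p_bound r_bound \<gamma> \<epsilon> obs)) \<and>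
        (\<forall>(S :: 'a set) R T sI G.
           dtmc S R T sI \<longrightarrow> G \<subseteq> S \<longrightarrow> reach_reward R T sI G < \<infinity> \<longrightarrow>
           card S \<le> S_bound \<longrightarrow> p_bound \<le> p_min S T \<longrightarrow> r_max S R \<le> r_bound \<longrightarrow>
             coverage R T sI G (k S_bound p_bound r_bound \<gamma> \<epsilon>) (A S_bound p_bound r_bound \<gamma> \<epsilon>)
               (enn2real (reach_reward R T sI G)) \<ge> \<gamma>)"
proof -
  define A :: "nat \<Rightarrow> real \<Rightarrow> real \<Rightarrow> real \<Rightarrow> real \<Rightarrow> 'a observation list \<Rightarrow> real set"
    where "A n p r \<gamma> \<epsilon> obs = {mean_reward obs - \<epsilon>..mean_reward obs + \<epsilon>}" for n p r \<gamma> \<epsilon> obs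
  \<comment> \<open>Isolates the guarantee as a property of the number of runs, so that this number
    can be chosen as a function of the parameters alone.\<close>
  define good where "good n p r \<gamma> \<epsilon> k \<longleftrightarrow>
    (\<forall>(S :: 'a set) R T sI G. dtmc S R T sI \<longrightarrow> G \<subseteq> S \<longrightarrow> reach_reward R T sI G < \<infinity> \<longrightarrow>
      card S \<le> n \<longrightarrow> p \<le> p_min S T \<longrightarrow> r_max S R \<le> r \<longrightarrow>
      coverage R T sI G k (A n p r \<gamma> \<epsilon>) (enn2real (reach_reward R T sI G)) \<ge> \<gamma>)"
    for n p r \<gamma> \<epsilon> k
  have ex: "\<exists>k. good n p r \<gamma> \<epsilon> k" if "0 < p" "0 \<le> r" "0 < \<gamma>" "\<gamma> < 1" "0 < \<epsilon>" for n p r \<gamma> \<epsilon>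
    using PAC_fixed_parameters[where 'a = 'a, OF that, of n] unfolding good_def A_def by blast
  have "interval_of_width (2 * \<epsilon>) (A n p r \<gamma> \<epsilon> obs)" if "0 < \<epsilon>" for n p r \<gamma> \<epsilon> obs
    using that unfolding interval_of_width_def A_def
    by (intro exI[of _ "mean_reward obs - \<epsilon>"] exI[of _ "mean_reward obs + \<epsilon>"]) auto
  moreover have "good n p r \<gamma> \<epsilon> (SOME k. good n p r \<gamma> \<epsilon> k)"
    if "0 < p" "0 \<le> r" "0 < \<gamma>" "\<gamma> < 1" "0 < \<epsilon>" for n p r \<gamma> \<epsilon>
    using ex[OF that] by (rule someI_ex)
  ultimately show ?thesis
    unfolding good_def
    by (intro exI[of _ "\<lambda>n p r \<gamma> \<epsilon>. SOME k. good n p r \<gamma> \<epsilon> k"] exI[of _ A]) (simp add: good_def)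
qed

end
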